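(* Let $p$ be a monic polynomial of degree $d$ with simple zeros $\lambda_1,\dots,\lambda_d$, let $n$ be a positive integer and let $\rho>0$. Assume that $\varphi$ is holomorphic in a neighborhood of $V(p,\rho)=\{z\in\mathbb{C} : |p(z)|\le\rho\}$ and is given in the multicentric form $$\varphi(z)=\sum_{j=1}^d \delta_j(z) f_j(w),\qquad w=p(z).$$ Then $$\varphi(z)=\sum_{j=1}^d \delta_j(z)\left[f_{j,0}(w^n)+w f_{j,1}(w^n)+\cdots+w^{n-1}f_{j,n-1}(w^n)\right],\qquad w=p(z),$$ where, for $1\le j\le d$ and $0\le k\le n-1$, the functions $w\mapsto f_{j,k}(w^n)$ are holomorphic in a neighborhood of the disc $|w|\le\rho$ and are given by $$w^k f_{j,k}(w^n)=\frac1n\left\{f_j(w)+e^{-2\pi i k/n}f_j(e^{2\pi i/n}w)+\dots+e^{-2\pi i (n-1)k/n}f_j(e^{2\pi i(n-1)/n}w)\right\}.$$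
   Context: $\delta_j(\lambda)=\frac{1}{p'(\lambda_j)}\prod_{l\ne j}(\lambda-\lambda_l)$ are the Lagrange interpolation basis polynomials at the roots $\lambda_1,\dots,\lambda_d$ of $p$. The functions $f_j$ of the multicentric representation of $\varphi$ are those obtained from $\varphi$ by $$f_j(w)=\sum_{l=1}^d\delta_l(\lambda_j,w)\,\varphi(\zeta_l(w)),\qquad \delta_l(\lambda,w)=\frac{p(\lambda)-w}{p'(\zeta_l(w))(\lambda-\zeta_l(w))},$$ where $\zeta_1(w),\dots,\zeta_d(w)$ are the roots of $p(\lambda)-w=0$ (removable singularities, e.g. at critical values of $p$, being filled in). When $\varphi$ is holomorphic in a neighborhood of $V(p,\rho)$, each $f_j$ is holomorphic in a neighborhood of $|w|\le\rho$. For $k\ge1$ the value $f_{j,k}(0)$ is understood by removing the singularity at $w=0$. *)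

theory Defs
  imports "HOL-Complex_Analysis.Complex_Analysis"
begin

definition poly_sublevel :: "complex poly \<Rightarrow> real \<Rightarrow> complex set" where
  "poly_sublevel p \<rho> = {z. cmod (poly p z) \<le> \<rho>}"

definition lagrange_basis :: "complex poly \<Rightarrow> (nat \<Rightarrow> complex) \<Rightarrow> nat \<Rightarrow> nat \<Rightarrow> complex \<Rightarrow> complex" where
  "lagrange_basis p lam d j z =
     1 / poly (pderiv p) (lam j) * (\<Prod>l\<in>{1..d} - {j}. z - lam l)"

text \<open>The basis polynomial at the root \<open>\<zeta>\<close> of \<open>p - w\<close>, evaluated at \<open>x\<close>.\<close>

definition lagrange_basis_at :: "complex poly \<Rightarrow> complex \<Rightarrow> complex \<Rightarrow> complex \<Rightarrow> complex" where
  "lagrange_basis_at p \<zeta> x w = (poly p x - w) / (poly (pderiv p) \<zeta> * (x - \<zeta>))"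

text \<open>
  The function \<open>f\<^sub>j\<close> of the multicentric representation is \<open>multicentric_fun p \<phi> (lam j)\<close>.
  Summing over the set of roots agrees with summing over \<open>\<zeta>\<^sub>1(w), \<dots>, \<zeta>\<^sub>d(w)\<close> whenever \<open>w\<close> is not
  a critical value of \<open>p\<close>. The values at critical values, and at \<open>w = 0\<close> (where the summand for
  \<open>\<zeta> = lam j\<close> has the form 0/0), are limits supplied by \<open>remove_sings\<close>.
\<close>

definition multicentric_fun :: "complex poly \<Rightarrow> (complex \<Rightarrow> complex) \<Rightarrow> complex \<Rightarrow> complex \<Rightarrow> complex" where
  "multicentric_fun p \<phi> x =
     remove_sings (\<lambda>w. \<Sum>\<zeta> | poly p \<zeta> = w. lagrange_basis_at p \<zeta> x w * \<phi> \<zeta>)"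

text \<open>
  The function \<open>f\<^sub>j\<^sub>,\<^sub>k\<close> is \<open>cyclic_component n k f\<^sub>j\<close>. It is a function of \<open>u = w ^ n\<close>, given by the
  formula for \<open>w ^ k * f\<^sub>j\<^sub>,\<^sub>k (w ^ n)\<close> at some \<open>n\<close>-th root \<open>w\<close> of \<open>u\<close>; that the root chosen is
  irrelevant is a property of the formula and not part of this definition. The value at
  \<open>u = 0\<close> is a limit supplied by \<open>remove_sings\<close>.
\<close>

definition cyclic_component :: "nat \<Rightarrow> nat \<Rightarrow> (complex \<Rightarrow> complex) \<Rightarrow> complex \<Rightarrow> complex" where
  "cyclic_component n k f =
     remove_sings (\<lambda>u. let w = (SOME w. w ^ n = u) in
       (1 / of_nat n * (\<Sum>m<n. exp (- (2 * of_real pi * \<i> * of_nat m * of_nat k / of_nat n)) *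
                                f (exp (2 * of_real pi * \<i> * of_nat m / of_nat n) * w))) / w ^ k)"

end

theory Submission
  imports Defs
begin

text \<open>
  Two independent facts are combined: the functions \<open>f\<^sub>j\<close> are holomorphic on a disc slightly larger
  than \<open>|w| \<le> \<rho>\<close> and represent \<open>\<phi>\<close> on its preimage, and any function \<open>g\<close> holomorphic on a disc
  splits into \<open>n\<close> pieces according to the residue class of the exponent in its Taylor series.

  For the first fact, write \<open>p = (X - \<lambda>\<^sub>j) q\<^sub>j\<close>. On the fibre \<open>p(\<zeta>) = w\<close> with \<open>w \<noteq> 0\<close> the coefficient
  \<open>\<delta>\<^sub>\<zeta>(\<lambda>\<^sub>j, w)\<close> is simply \<open>q\<^sub>j(\<zeta>) / p'(\<zeta>)\<close>, so \<open>f\<^sub>j\<close> has the shape \<open>\<Sum> h(\<zeta>) / p'(\<zeta>)\<close> (sum over the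
  fibre) with \<open>h = q\<^sub>j \<phi>\<close> holomorphic. At a regular value the fibre moves holomorphically, along local
  inverses of \<open>p\<close> (\<open>fibre_sum_analytic_at_regular_value\<close>). At a critical value \<open>w\<^sub>0\<close> the summands may
  blow up, but \<open>(p - w\<^sub>0) / p'\<close> tends to 0 at every zero of \<open>p - w\<^sub>0\<close>, whatever its multiplicity;
  hence \<open>(w - w\<^sub>0) f\<^sub>j(w)\<close> tends to 0 and Riemann's theorem removes the singularity
  (\<open>fibre_sum_at_critical_value\<close>). Both steps use that a non-constant polynomial is a closed map, so
  that the points of nearby fibres stay near the given fibre. The same closedness turns a
  neighbourhood of \<open>V(p, \<rho>)\<close> into one of the form \<open>|p(z)| < R\<close> with \<open>R > \<rho>\<close>.

  The representation of \<open>\<phi>\<close> on \<open>|p(z)| < R\<close> is Lagrange interpolation of the Bezout quotient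
  \<open>(p(X) - p(\<zeta>)) / (X - \<zeta>)\<close> at the roots of \<open>p\<close> (\<open>bezout_interpolation\<close>): evaluated at a point \<open>z\<close> of
  the fibre of \<open>\<zeta>\<close>, that quotient is \<open>p'(\<zeta>)\<close> if \<open>z = \<zeta>\<close> and 0 otherwise, so only \<open>\<phi>(z)\<close> survives. This
  works at regular values, and the finitely many points over critical values follow by continuity.

  For the second fact, averaging \<open>g\<close> over the rotations by \<open>n\<close>-th roots of unity with weights
  \<open>e\<^bsup>-2\<pi>imk/n\<^esup>\<close> keeps exactly the Taylor terms \<open>a\<^sub>i w\<^sup>i\<close> with \<open>i \<equiv> k\<close> modulo \<open>n\<close>. What remains is
  \<open>w\<^sup>k\<close> times a power series in \<open>w\<^sup>n\<close>, and that power series is the function \<open>f\<^sub>j\<^sub>,\<^sub>k\<close>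
  (\<open>cyclic_component_power\<close>).
\<close>

section \<open>Fibres of a complex polynomial\<close>

lemma finite_poly_fibre:
  fixes p :: "complex poly"
  assumes "degree p > 0"
  shows "finite {z. poly p z = w}" and "card {z. poly p z = w} \<le> degree p"
proof -
  have ne: "p - [:w:] \<noteq> 0"
    using assms by auto
  have deg: "degree (p - [:w:]) \<le> degree p"
    by (rule degree_diff_le) auto
  have eq: "{z. poly p z = w} = {z. poly (p - [:w:]) z = 0}"
    by auto
  show "finite {z. poly p z = w}"
    unfolding eq by (rule poly_roots_finite[OF ne])
  show "card {z. poly p z = w} \<le> degree p"
    unfolding eq using card_poly_roots_bound[OF ne] deg by linarith
qed

text \<open>
  Since \<open>p\<close> tends to infinity at infinity, a sequence with convergent image is bounded, and a
  subsequence of it converges.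
\<close>

lemma closed_poly_image:
  fixes p :: "complex poly"
  assumes "degree p > 0" and "closed A"
  shows "closed (poly p ` A)"
  unfolding closed_sequential_limits
proof (intro allI impI, elim conjE)
  fix y l
  assume y: "\<forall>n. y n \<in> poly p ` A" and lim: "y \<longlonglongrightarrow> l"
  define x where "x = (\<lambda>n. inv_into A (poly p) (y n))"
  have x: "x n \<in> A" "y n = poly p (x n)" for n
    using y by (auto simp: x_def f_inv_into_f inv_into_into)
  obtain M where M: "\<And>n. norm (y n) < M"
    using lim convergent_imp_bounded[OF lim] by (auto simp: bounded_pos_less)
  have "eventually (\<lambda>z. M \<le> norm (poly p z)) at_infinity"
    using filterlim_poly_at_infinity[OF assms(1)]
    by (auto simp: filterlim_at_infinity_conv_norm_at_top filterlim_at_top)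
  then obtain b where b: "\<And>z. b \<le> norm z \<Longrightarrow> M \<le> norm (poly p z)"
    by (auto simp: eventually_at_infinity)
  have "norm (x n) \<le> b" for n
    using b[of "x n"] M[of n] x(2)[of n] by (cases "b \<le> norm (x n)") auto
  then have "\<forall>n. x n \<in> cball 0 b"
    by simp
  then obtain a r where r: "strict_mono r" "(x \<circ> r) \<longlonglongrightarrow> a"
    using compact_cball[of "0::complex" b] seq_compactE[of "cball 0 b" x]
    by (metis compact_eq_seq_compact_metric)
  have "a \<in> A"
    using closed_sequentially[OF assms(2) _ r(2)] x(1) by auto
  moreover have "(\<lambda>n. poly p ((x \<circ> r) n)) \<longlonglongrightarrow> poly p a"
    by (rule tendsto_poly[OF r(2)])
  then have "(y \<circ> r) \<longlonglongrightarrow> poly p a"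
    using x(2) by (simp add: o_def)
  then have "poly p a = l"
    using LIMSEQ_subseq_LIMSEQ[OF lim r(1)] LIMSEQ_unique by blast
  ultimately show "l \<in> poly p ` A"
    by blast
qed

text \<open>
  Upper semicontinuity of the fibre: the image of the complement of a neighbourhood of the fibre over
  \<open>w\<^sub>0\<close> is closed and misses \<open>w\<^sub>0\<close>.
\<close>

lemma eventually_poly_fibre:
  fixes p :: "complex poly"
  assumes "degree p > 0" and "\<And>z. poly p z = w\<^sub>0 \<Longrightarrow> eventually P (nhds z)"
  shows "eventually (\<lambda>w. \<forall>z. poly p z = w \<longrightarrow> P z) (nhds w\<^sub>0)"
proof -
  define V where "V = interior {z. P z}"
  have V: "z \<in> V" if "poly p z = w\<^sub>0" for z
    using assms(2)[OF that] by (auto simp: V_def interior_def eventually_nhds)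
  have "open (- (poly p ` (- V)))"
    by (intro open_Compl closed_poly_image[OF assms(1)]) (simp add: V_def closed_Compl)
  moreover have "w\<^sub>0 \<in> - (poly p ` (- V))"
    using V by auto
  ultimately have "eventually (\<lambda>w. w \<in> - (poly p ` (- V))) (nhds w\<^sub>0)"
    by (rule eventually_nhds_in_open)
  then show ?thesis
  proof eventually_elim
    case (elim w)
    then show ?case
      using interior_subset[of "{z. P z}"] by (auto simp: V_def)
  qed
qed

section \<open>Sums over fibres\<close>

text \<open>
  For \<open>w\<close> a regular value this is the sum of the residues of \<open>h / (p - w)\<close>, the shape to which all
  the functions of the multicentric representation reduce.
\<close>

definition fibre_sum :: "complex poly \<Rightarrow> (complex \<Rightarrow> complex) \<Rightarrow> complex \<Rightarrow> complex" where
  "fibre_sum p h w = (\<Sum>\<zeta> | poly p \<zeta> = w. h \<zeta> / poly (pderiv p) \<zeta>)"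

text \<open>
  Near each point \<open>\<zeta>\<close> of the fibre, \<open>p\<close> has a holomorphic inverse \<open>g \<zeta>\<close>. For \<open>w\<close> near \<open>w\<^sub>0\<close> the points
  \<open>g \<zeta> w\<close> exhaust the fibre over \<open>w\<close>, by \<open>eventually_poly_fibre\<close>, and are distinct, by continuity. So
  the sum over a moving fibre becomes a sum of holomorphic functions over a fixed index set.
\<close>

lemma fibre_sum_analytic_at_regular_value:
  fixes p :: "complex poly"
  assumes deg: "degree p > 0" and B: "open B" "w\<^sub>0 \<in> B"
    and h: "h holomorphic_on {z. poly p z \<in> B}"
    and reg: "\<And>\<zeta>. poly p \<zeta> = w\<^sub>0 \<Longrightarrow> poly (pderiv p) \<zeta> \<noteq> 0"
  shows "fibre_sum p h analytic_on {w\<^sub>0}"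
proof -
  define Z where "Z = {\<zeta>. poly p \<zeta> = w\<^sub>0}"
  define U where "U = {z. poly p z \<in> B}"
  have finZ: "finite Z"
    unfolding Z_def by (rule finite_poly_fibre[OF deg])
  have openU: "open U"
    unfolding U_def using open_vimage[OF B(1), of "poly p"]
    by (simp add: vimage_def continuous_on_poly)
  let ?Q = "\<lambda>\<zeta> S g. open S \<and> \<zeta> \<in> S \<and> S \<subseteq> U \<and> open (poly p ` S) \<and>
              g holomorphic_on (poly p ` S) \<and> (\<forall>z\<in>S. g (poly p z) = z)"
  have "\<exists>S g. ?Q \<zeta> S g" if \<zeta>: "\<zeta> \<in> Z" for \<zeta>
  proof -
    have holp: "poly p holomorphic_on U"
      by (intro holomorphic_intros)
    have "\<zeta> \<in> U" "deriv (poly p) \<zeta> \<noteq> 0"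
      using \<zeta> reg B(2) by (auto simp: Z_def U_def DERIV_imp_deriv[OF poly_DERIV])
    then obtain r where r: "r > 0" "ball \<zeta> r \<subseteq> U" "open (poly p ` ball \<zeta> r)" "inj_on (poly p) (ball \<zeta> r)"
      using has_complex_derivative_locally_invertible[OF holp _ openU] by metis
    obtain g where "g holomorphic_on (poly p ` ball \<zeta> r)" "\<And>z. z \<in> ball \<zeta> r \<Longrightarrow> g (poly p z) = z"
      using holomorphic_has_inverse[OF holomorphic_on_subset[OF holp r(2)] _ r(4)] by blast
    then show ?thesis
      using r by (intro exI[of _ "ball \<zeta> r"] exI[of _ g]) auto
  qed
  then have "\<forall>\<zeta>\<in>Z. \<exists>S g. ?Q \<zeta> S g"
    by blast
  from bchoice[OF this] obtain S where "\<forall>\<zeta>\<in>Z. \<exists>g. ?Q \<zeta> (S \<zeta>) g"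
    by blast
  from bchoice[OF this] obtain g where "\<forall>\<zeta>\<in>Z. ?Q \<zeta> (S \<zeta>) (g \<zeta>)"
    by blast
  then have S: "\<And>\<zeta>. \<zeta> \<in> Z \<Longrightarrow> open (S \<zeta>)" "\<And>\<zeta>. \<zeta> \<in> Z \<Longrightarrow> \<zeta> \<in> S \<zeta>"
      "\<And>\<zeta>. \<zeta> \<in> Z \<Longrightarrow> S \<zeta> \<subseteq> U" "\<And>\<zeta>. \<zeta> \<in> Z \<Longrightarrow> open (poly p ` S \<zeta>)"
    and g: "\<And>\<zeta>. \<zeta> \<in> Z \<Longrightarrow> g \<zeta> holomorphic_on (poly p ` S \<zeta>)"
      "\<And>\<zeta> z. \<zeta> \<in> Z \<Longrightarrow> z \<in> S \<zeta> \<Longrightarrow> g \<zeta> (poly p z) = z"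
    by blast+
  have w0: "w\<^sub>0 \<in> poly p ` S \<zeta>" "g \<zeta> w\<^sub>0 = \<zeta>" if "\<zeta> \<in> Z" for \<zeta>
    using S(2)[OF that] g(2)[OF that S(2)[OF that]] that by (auto simp: Z_def)
  have ana_g: "g \<zeta> analytic_on {w\<^sub>0}" if "\<zeta> \<in> Z" for \<zeta>
    using that S(4) g(1) w0(1) analytic_at by blast
  have "eventually (\<lambda>w. \<forall>\<zeta>\<in>Z. w \<in> poly p ` S \<zeta>) (nhds w\<^sub>0)"
    by (intro eventually_ball_finite finZ ballI eventually_nhds_in_open S(4) w0(1))
  moreover have "eventually (\<lambda>w. \<forall>z. poly p z = w \<longrightarrow> (\<exists>\<zeta>\<in>Z. z \<in> S \<zeta>)) (nhds w\<^sub>0)"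
  proof (rule eventually_poly_fibre[OF deg])
    fix z assume "poly p z = w\<^sub>0"
    then have z: "z \<in> Z"
      by (simp add: Z_def)
    show "\<forall>\<^sub>F z in nhds z. \<exists>\<zeta>\<in>Z. z \<in> S \<zeta>"
      using eventually_nhds_in_open[OF S(1,2)[OF z]] by eventually_elim (use z in blast)
  qed
  moreover have "eventually (\<lambda>w. \<forall>\<zeta>\<in>Z. \<forall>\<zeta>'\<in>Z. \<zeta> \<noteq> \<zeta>' \<longrightarrow> g \<zeta> w \<noteq> g \<zeta>' w) (nhds w\<^sub>0)"
  proof (intro eventually_ball_finite finZ ballI)
    fix \<zeta> \<zeta>' assume Z: "\<zeta> \<in> Z" "\<zeta>' \<in> Z"
    show "\<forall>\<^sub>F w in nhds w\<^sub>0. \<zeta> \<noteq> \<zeta>' \<longrightarrow> g \<zeta> w \<noteq> g \<zeta>' w"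
    proof (cases "\<zeta> = \<zeta>'")
      case False
      have "(\<lambda>w. g \<zeta> w - g \<zeta>' w) analytic_on {w\<^sub>0}"
        by (intro analytic_intros ana_g Z)
      then have "((\<lambda>w. g \<zeta> w - g \<zeta>' w) \<longlongrightarrow> g \<zeta> w\<^sub>0 - g \<zeta>' w\<^sub>0) (nhds w\<^sub>0)"
        using analytic_at_imp_isCont by (simp add: isCont_def tendsto_at_iff_tendsto_nhds)
      moreover have "g \<zeta> w\<^sub>0 - g \<zeta>' w\<^sub>0 \<noteq> 0"
        using False w0(2) Z by simp
      ultimately have "\<forall>\<^sub>F w in nhds w\<^sub>0. g \<zeta> w - g \<zeta>' w \<noteq> 0"
        by (rule tendsto_imp_eventually_ne)
      then show ?thesis
        by eventually_elim auto
    qed auto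
  qed
  ultimately have "eventually (\<lambda>w. fibre_sum p h w = (\<Sum>\<zeta>\<in>Z. h (g \<zeta> w) / poly (pderiv p) (g \<zeta> w))) (nhds w\<^sub>0)"
  proof eventually_elim
    case (elim w)
    have "{z. poly p z = w} = (\<lambda>\<zeta>. g \<zeta> w) ` Z"
    proof (intro set_eqI iffI)
      fix z assume "z \<in> {z. poly p z = w}"
      then show "z \<in> (\<lambda>\<zeta>. g \<zeta> w) ` Z"
        using elim(2) g(2) by force
    next
      fix z assume "z \<in> (\<lambda>\<zeta>. g \<zeta> w) ` Z"
      then obtain \<zeta> where \<zeta>: "\<zeta> \<in> Z" "z = g \<zeta> w"
        by auto
      with elim(1) obtain y where "y \<in> S \<zeta>" "w = poly p y"
        by blast
      with \<zeta> g(2) show "z \<in> {z. poly p z = w}"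
        by auto
    qed
    moreover have "inj_on (\<lambda>\<zeta>. g \<zeta> w) Z"
      using elim(3) by (auto simp: inj_on_def)
    ultimately show ?case
      by (simp add: fibre_sum_def sum.reindex)
  qed
  moreover have "(\<lambda>w. \<Sum>\<zeta>\<in>Z. h (g \<zeta> w) / poly (pderiv p) (g \<zeta> w)) analytic_on {w\<^sub>0}"
  proof (rule analytic_on_sum)
    fix \<zeta> assume \<zeta>: "\<zeta> \<in> Z"
    have "h analytic_on {\<zeta>}"
      using h openU S(2,3)[OF \<zeta>] unfolding U_def[symmetric] analytic_at by blast
    then have 1: "(h \<circ> g \<zeta>) analytic_on {w\<^sub>0}"
      by (intro analytic_on_compose ana_g \<zeta>) (simp add: w0(2)[OF \<zeta>])
    have "poly (pderiv p) analytic_on {g \<zeta> w\<^sub>0}"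
      by (rule holomorphic_on_imp_analytic_at[of _ UNIV]) (auto intro!: holomorphic_intros)
    then have 2: "(poly (pderiv p) \<circ> g \<zeta>) analytic_on {w\<^sub>0}"
      by (intro analytic_on_compose ana_g \<zeta>) simp
    have "(poly (pderiv p) \<circ> g \<zeta>) w\<^sub>0 \<noteq> 0"
      using w0(2)[OF \<zeta>] reg[of \<zeta>] \<zeta> by (simp add: Z_def)
    then show "(\<lambda>w. h (g \<zeta> w) / poly (pderiv p) (g \<zeta> w)) analytic_on {w\<^sub>0}"
      using analytic_on_divide[OF 1 2] by (simp add: o_def)
  qed
  ultimately show ?thesis
    by (subst analytic_at_cong[OF _ refl])
qed

text \<open>
  At a zero of order \<open>m\<close> the quotient behaves like \<open>(z - a) / m\<close>. The limit is stated along \<open>nhds a\<close>,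
  including \<open>a\<close> itself, where the numerator vanishes; this lets it be combined with
  \<open>eventually_poly_fibre\<close>.
\<close>

lemma poly_div_pderiv_tendsto_0:
  fixes p :: "complex poly"
  assumes "p \<noteq> 0" "poly p a = 0"
  shows "((\<lambda>z. poly p z / poly (pderiv p) z) \<longlongrightarrow> 0) (nhds a)"
proof -
  define m where "m = order a p"
  obtain q where q: "p = [:-a, 1:] ^ m * q" "\<not> [:-a, 1:] dvd q"
    using order_decomp[OF assms(1), of a] unfolding m_def by blast
  have "m > 0"
    using assms order_root[of p a] by (simp add: m_def)
  then obtain k where k: "m = Suc k"
    using gr0_conv_Suc by blast
  have qa: "poly q a \<noteq> 0"
    using q(2) by (simp add: poly_eq_0_iff_dvd)
  define r where "r = smult (of_nat m) q + [:-a, 1:] * pderiv q"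
  have p': "pderiv p = [:-a, 1:] ^ k * r"
    unfolding q(1) k r_def pderiv_mult pderiv_power_Suc by (simp add: pderiv_pCons algebra_simps)
  have eq: "poly p z / poly (pderiv p) z = (z - a) * poly q z / poly r z" if "z \<noteq> a" for z
  proof -
    have "poly p z = (z - a) ^ k * ((z - a) * poly q z)"
      by (subst q(1)) (simp add: k algebra_simps)
    moreover have "poly (pderiv p) z = (z - a) ^ k * poly r z"
      by (simp add: p')
    ultimately show ?thesis
      using that by simp
  qed
  have "poly r a \<noteq> 0"
    using qa k by (simp add: r_def del: of_nat_Suc)
  then have "((\<lambda>z. (z - a) * poly q z / poly r z) \<longlongrightarrow> (a - a) * poly q a / poly r a) (at a)"
    by (intro tendsto_intros)
  then have "((\<lambda>z. poly p z / poly (pderiv p) z) \<longlongrightarrow> 0) (at a)"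
    using eq by (subst filterlim_cong[OF refl refl, where g = "\<lambda>z. (z - a) * poly q z / poly r z"])
      (auto simp: eventually_at_filter)
  then show ?thesis
    using assms(2) tendsto_at_iff_tendsto_nhds[of "\<lambda>z. poly p z / poly (pderiv p) z" a] by simp
qed

text \<open>
  On the fibre over \<open>w\<close> the factor \<open>w - w\<^sub>0\<close> equals \<open>p(\<zeta>) - w\<^sub>0\<close>, so each summand of the product is
  \<open>h\<close> times a quotient as in \<open>poly_div_pderiv_tendsto_0\<close>, and there are at most \<open>degree p\<close> summands.
\<close>

lemma fibre_sum_at_critical_value:
  fixes p :: "complex poly"
  assumes deg: "degree p > 0" and B: "open B" "w\<^sub>0 \<in> B"
    and h: "continuous_on {z. poly p z \<in> B} h"
  shows "((\<lambda>w. (w - w\<^sub>0) * fibre_sum p h w) \<longlongrightarrow> 0) (at w\<^sub>0)"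
proof (rule tendstoI)
  fix e :: real assume e: "e > 0"
  \<comment> \<open>At most \<open>degree p\<close> summands of norm below \<open>c\<close> add up to less than \<open>e\<close>.\<close>
  define c where "c = e / (real (degree p) + 1)"
  have c: "c > 0"
    using e by (simp add: c_def)
  let ?t = "\<lambda>z. poly (p - [:w\<^sub>0:]) z / poly (pderiv (p - [:w\<^sub>0:])) z * h z"
  have openU: "open {z. poly p z \<in> B}"
    using open_vimage[OF B(1), of "poly p"] by (simp add: vimage_def continuous_on_poly)
  have "eventually (\<lambda>w. \<forall>z. poly p z = w \<longrightarrow> norm (?t z) < c) (nhds w\<^sub>0)"
  proof (rule eventually_poly_fibre[OF deg])
    fix z assume z: "poly p z = w\<^sub>0"
    have "p - [:w\<^sub>0:] \<noteq> 0"
      using deg by auto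
    then have "((\<lambda>z. poly (p - [:w\<^sub>0:]) z / poly (pderiv (p - [:w\<^sub>0:])) z) \<longlongrightarrow> 0) (nhds z)"
      using z by (intro poly_div_pderiv_tendsto_0) auto
    moreover have "isCont h z"
      using h openU z B(2) continuous_on_eq_continuous_at[OF openU] by auto
    then have "(h \<longlongrightarrow> h z) (nhds z)"
      by (simp add: isCont_def tendsto_at_iff_tendsto_nhds)
    ultimately have "(?t \<longlongrightarrow> 0 * h z) (nhds z)"
      by (intro tendsto_mult)
    then show "eventually (\<lambda>z. norm (?t z) < c) (nhds z)"
      using tendstoD[OF _ c, of ?t 0] by simp
  qed
  then have "eventually (\<lambda>w. dist ((w - w\<^sub>0) * fibre_sum p h w) 0 < e) (nhds w\<^sub>0)"
  proof eventually_elim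
    case (elim w)
    have "norm ((w - w\<^sub>0) * fibre_sum p h w) = norm (\<Sum>\<zeta> | poly p \<zeta> = w. ?t \<zeta>)"
      by (simp add: fibre_sum_def sum_distrib_left pderiv_diff pderiv_pCons)
    also have "\<dots> \<le> of_nat (card {\<zeta>. poly p \<zeta> = w}) * c"
      by (rule sum_norm_bound) (use elim in auto)
    also have "\<dots> \<le> real (degree p) * c"
      using finite_poly_fibre(2)[OF deg, of w] c by (simp add: mult_right_mono)
    also have "\<dots> < e"
      using e unfolding c_def by (simp add: field_simps)
    finally show ?case
      by simp
  qed
  then show "eventually (\<lambda>w. dist ((w - w\<^sub>0) * fibre_sum p h w) 0 < e) (at w\<^sub>0)"
    by (simp add: eventually_at_filter eventually_mono)
qed

lemma finite_critical_points:
  fixes p :: "complex poly"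
  assumes "degree p > 0"
  shows "finite {z. poly (pderiv p) z = 0}"
  using assms by (intro poly_roots_finite) (auto simp: pderiv_eq_0_iff)

lemma remove_sings_fibre_sum_holomorphic:
  fixes p :: "complex poly"
  assumes deg: "degree p > 0" and B: "open B" and h: "h holomorphic_on {z. poly p z \<in> B}"
  shows "remove_sings (fibre_sum p h) holomorphic_on B"
proof -
  define C where "C = poly p ` {z. poly (pderiv p) z = 0}"
  have finC: "finite C"
    unfolding C_def using finite_critical_points[OF deg] by simp
  have reg: "fibre_sum p h analytic_on {w}" if "w \<in> B - C" for w
    using that by (intro fibre_sum_analytic_at_regular_value[OF deg B _ h]) (auto simp: C_def)
  have "remove_sings (fibre_sum p h) analytic_on {w}" if w: "w \<in> B" for w
  proof -
    \<comment> \<open>A neighbourhood of \<open>w\<close> in which no other critical value lies.\<close>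
    define A where "A = B - (C - {w})"
    have A: "open A" "w \<in> A"
      using w finC B by (auto simp: A_def intro!: open_Diff finite_imp_closed)
    have ana: "fibre_sum p h analytic_on A - {w}"
      using reg unfolding A_def by (subst analytic_on_analytic_at) auto
    then have sing: "isolated_singularity_at (fibre_sum p h) w"
      using A isolated_singularity_at_iff_analytic_nhd by blast
    have "((\<lambda>v. (v - w) * fibre_sum p h v) \<longlongrightarrow> 0) (at w)"
      by (rule fibre_sum_at_critical_value[OF deg B w holomorphic_on_imp_continuous_on[OF h]])
    then obtain g where g: "g holomorphic_on A" "\<And>z. z \<in> A - {w} \<Longrightarrow> g z = fibre_sum p h z"
      using holomorphic_on_extend_lim[OF analytic_imp_holomorphic[OF ana], of] A
      by (metis interior_open)
    have "isCont g w"
      using g(1) A continuous_on_eq_continuous_at holomorphic_on_imp_continuous_on by blast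
    then have "g \<midarrow>w\<rightarrow> g w"
      by (simp add: isCont_def)
    moreover have "eventually (\<lambda>z. z \<in> A - {w}) (at w)"
      using A by (intro eventually_at_in_open) auto
    then have "eventually (\<lambda>z. g z = fibre_sum p h z) (at w)"
      by eventually_elim (rule g(2))
    ultimately have "fibre_sum p h \<midarrow>w\<rightarrow> g w"
      using filterlim_cong by blast
    with sing show ?thesis
      by (rule remove_sings_analytic_at)
  qed
  then show ?thesis
    using analytic_on_analytic_at analytic_imp_holomorphic by blast
qed

section \<open>Cyclic components of a holomorphic function\<close>

definition cyclic_average :: "nat \<Rightarrow> nat \<Rightarrow> (complex \<Rightarrow> complex) \<Rightarrow> complex \<Rightarrow> complex" where
  "cyclic_average n k g w =
     1 / of_nat n * (\<Sum>m<n. exp (- (2 * of_real pi * \<i> * of_nat m * of_nat k / of_nat n)) *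
                             g (exp (2 * of_real pi * \<i> * of_nat m / of_nat n) * w))"

text \<open>
  The orthogonality relation for the characters of the cyclic group of order \<open>n\<close>: the terms are the
  powers of an \<open>n\<close>-th root of unity that is 1 exactly when \<open>i \<equiv> k\<close>.
\<close>

lemma sum_root_of_unity_characters:
  assumes "n > 0"
  shows "(\<Sum>m<n. exp (- (2 * of_real pi * \<i> * of_nat m * of_nat k / of_nat n)) *
                  exp (2 * of_real pi * \<i> * of_nat m / of_nat n) ^ i) =
         (if i mod n = k mod n then of_nat n else (0 :: complex))"
proof -
  define e where "e = (\<lambda>j::nat. exp (2 * of_real pi * \<i> * of_nat j / of_nat n) :: complex)"
  define z where "z = e i / e k"
  have "exp (- (2 * of_real pi * \<i> * of_nat m * of_nat k / of_nat n)) *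
        exp (2 * of_real pi * \<i> * of_nat m / of_nat n) ^ i = z ^ m" for m
    by (simp add: z_def e_def exp_diff[symmetric] exp_of_nat_mult[symmetric] mult_exp_exp algebra_simps)
  then have sum: "(\<Sum>m<n. exp (- (2 * of_real pi * \<i> * of_nat m * of_nat k / of_nat n)) *
                  exp (2 * of_real pi * \<i> * of_nat m / of_nat n) ^ i) = (\<Sum>m<n. z ^ m)"
    by simp
  have "z ^ n = 1"
    using assms complex_root_unity[of n] by (simp add: z_def power_divide e_def)
  moreover have "z = 1 \<longleftrightarrow> i mod n = k mod n"
    using complex_root_unity_eq[of n i k] assms by (simp add: z_def e_def)
  ultimately show ?thesis
    unfolding sum using geometric_sum[of z n] by (cases "z = 1") auto
qed

lemma sum_cyclic_average:
  assumes "n > 0"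
  shows "(\<Sum>k<n. cyclic_average n k g w) = g w"
proof -
  let ?e = "\<lambda>m. exp (2 * of_real pi * \<i> * of_nat m / of_nat n) :: complex"
  have inner: "(\<Sum>k<n. exp (- (2 * of_real pi * \<i> * of_nat m * of_nat k / of_nat n)) :: complex)
           = (if m = 0 then of_nat n else 0)" if "m < n" for m
    \<comment> \<open>Orthogonality with exponent 0 and the roles of \<open>m\<close> and \<open>k\<close> exchanged.\<close>
    using sum_root_of_unity_characters[OF assms, of m 0] that
    by (simp add: mult_ac)
  have "(\<Sum>k<n. cyclic_average n k g w) = 1 / of_nat n *
      (\<Sum>m<n. (\<Sum>k<n. exp (- (2 * of_real pi * \<i> * of_nat m * of_nat k / of_nat n))) * g (?e m * w))"
    unfolding cyclic_average_def sum_distrib_left[symmetric]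
    by (subst sum.swap) (simp add: sum_distrib_right)
  also have "\<dots> = 1 / of_nat n * (\<Sum>m<n. if m = 0 then of_nat n * g w else 0)"
    by (intro arg_cong2[of _ _ _ _ "(*)"] refl sum.cong) (auto simp: inner)
  also have "\<dots> = g w"
    using assms by simp
  finally show ?thesis .
qed

text \<open>
  Averaging multiplies the Taylor term of index \<open>i\<close> by a character sum, which is 1 or 0 after the
  division by \<open>n\<close>.
\<close>

lemma cyclic_average_sums:
  assumes "n > 0" "k < n"
    and sums: "\<And>v. v \<in> ball 0 R \<Longrightarrow> (\<lambda>i. a i * v ^ i) sums g v"
    and w: "w \<in> ball 0 R"
  shows "(\<lambda>l. a (l * n + k) * w ^ (l * n + k)) sums cyclic_average n k g w"
proof -
  let ?c = "\<lambda>m. exp (- (2 * of_real pi * \<i> * of_nat m * of_nat k / of_nat n)) :: complex"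
  let ?e = "\<lambda>m. exp (2 * of_real pi * \<i> * of_nat m / of_nat n) :: complex"
  have e: "?e m * w \<in> ball 0 R" for m
    using w by (simp add: norm_mult norm_exp_eq_Re)
  have "(\<lambda>i. 1 / of_nat n * (\<Sum>m<n. ?c m * (a i * (?e m * w) ^ i))) sums cyclic_average n k g w"
    unfolding cyclic_average_def by (intro sums_mult sums_sum sums e)
  moreover have "1 / of_nat n * (\<Sum>m<n. ?c m * (a i * (?e m * w) ^ i)) =
      (if i mod n = k then a i * w ^ i else 0)" for i
  proof -
    have "(\<Sum>m<n. ?c m * (a i * (?e m * w) ^ i)) = a i * w ^ i * (\<Sum>m<n. ?c m * ?e m ^ i)"
      unfolding sum_distrib_left by (intro sum.cong refl) (simp add: power_mult_distrib mult_ac)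
    then show ?thesis
      using assms(1,2) sum_root_of_unity_characters[OF assms(1), of k i] by simp
  qed
  ultimately have "(\<lambda>i. if i mod n = k then a i * w ^ i else 0) sums cyclic_average n k g w"
    by simp
  moreover have "strict_mono (\<lambda>l. l * n + k)"
    using assms(1) by (simp add: strict_mono_def)
  moreover have "(if i mod n = k then a i * w ^ i else 0) = 0" if "i \<notin> range (\<lambda>l. l * n + k)" for i
    using that div_mult_mod_eq[of i n] by (metis rangeI)
  ultimately have "(\<lambda>l. if (l * n + k) mod n = k then a (l * n + k) * w ^ (l * n + k) else 0)
      sums cyclic_average n k g w"
    using sums_mono_reindex[of "\<lambda>l. l * n + k" "\<lambda>i. if i mod n = k then a i * w ^ i else 0"] by blast
  then show ?thesis
    using assms(2) by simp
qed

text \<open>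
  By \<open>cyclic_average_sums\<close> the average is \<open>w\<^sup>k\<close> times the value at \<open>w\<^sup>n\<close> of a power series. That
  power series converges at every point of the disc of radius \<open>R\<^sup>n\<close>, as such a point has an \<open>n\<close>-th root
  of norm below \<open>R\<close>; its sum is therefore holomorphic there, and it agrees away from 0 with the
  function under \<open>remove_sings\<close> in the definition of \<open>cyclic_component\<close>, whichever root is chosen.
\<close>

lemma cyclic_component_power:
  assumes n: "n > 0" "k < n" and R: "R > 0" and g: "g holomorphic_on ball 0 R"
  shows "(\<lambda>w. cyclic_component n k g (w ^ n)) holomorphic_on ball 0 R"
    and "w \<in> ball 0 R \<Longrightarrow> w ^ k * cyclic_component n k g (w ^ n) = cyclic_average n k g w"
proof -
  define a where "a = (\<lambda>i. (deriv ^^ i) g 0 / fact i)"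
  have average: "(\<lambda>l. a (l * n + k) * v ^ (l * n + k)) sums cyclic_average n k g v"
    if "v \<in> ball 0 R" for v
  proof (rule cyclic_average_sums[OF n _ that])
    show "(\<lambda>i. a i * v ^ i) sums g v" if "v \<in> ball 0 R" for v
      using holomorphic_power_series[OF g that] by (simp add: a_def)
  qed
  define root where "root = (\<lambda>u::complex. SOME v. v ^ n = u)"
  have root: "root u ^ n = u" for u
    unfolding root_def by (rule someI_ex) (use n exists_complex_root[of n u] in auto)
  have root_eq: "(SOME v. v ^ n = u) = root u" for u
    by (simp add: root_def)
  \<comment> \<open>The value \<open>a k\<close> at 0 is the constant term of the power series summed by \<open>h\<close>.\<close>
  define h where "h = (\<lambda>u. if u = 0 then a k else cyclic_average n k g (root u) / root u ^ k)"
  have in_ball: "v \<in> ball 0 R \<longleftrightarrow> v ^ n \<in> ball 0 (R ^ n)" for v :: complex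
    using R n power_mono_iff[of R "norm v" n] by (simp add: norm_power not_le[symmetric])
  have h_sums: "(\<lambda>l. a (l * n + k) * (u - 0) ^ l) sums h u" if u: "u \<in> ball 0 (R ^ n)" for u
  proof (cases "u = 0")
    case True
    then show ?thesis
      using powser_sums_zero[of "\<lambda>l. a (l * n + k)"] by (simp add: h_def)
  next
    case False
    then have r: "root u \<noteq> 0"
      using root[of u] n by (auto simp: zero_power)
    have "(\<lambda>l. a (l * n + k) * root u ^ (l * n + k) / root u ^ k) sums
            (cyclic_average n k g (root u) / root u ^ k)"
      using u by (intro sums_divide average iffD2[OF in_ball]) (simp add: root)
    moreover have "root u ^ (l * n + k) / root u ^ k = u ^ l" for l
    proof -
      have "root u ^ (l * n) = u ^ l"
        by (subst mult.commute) (simp add: power_mult root)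
      then show ?thesis
        using r by (simp add: power_add)
    qed
    ultimately show ?thesis
      using False by (simp add: h_def times_divide_eq_right[symmetric] del: times_divide_eq_right)
  qed
  have hol: "h holomorphic_on ball 0 (R ^ n)"
    by (rule power_series_holomorphic[OF h_sums])
  have component: "cyclic_component n k g u = h u" if u: "u \<in> ball 0 (R ^ n)" for u
  proof -
    have "h analytic_on {u}"
      using hol u analytic_at by blast
    then have "remove_sings h u = h u"
      by (rule remove_sings_at_analytic)
    moreover have "cyclic_component n k g u = remove_sings h u"
      unfolding cyclic_component_def Let_def root_eq
    proof (rule remove_sings_cong)
      have "eventually (\<lambda>v. v \<noteq> 0) (at u)"
        by (rule eventually_neq_at_within)
      then show "eventually (\<lambda>v. 1 / of_nat n * (\<Sum>m<n. exp (- (2 * of_real pi * \<i> * of_nat m * of_nat k / of_nat n)) *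
           g (exp (2 * of_real pi * \<i> * of_nat m / of_nat n) * root v)) / root v ^ k = h v) (at u)"
        by eventually_elim (simp add: h_def cyclic_average_def)
    qed simp
    ultimately show ?thesis
      by simp
  qed
  have "(\<lambda>w. h (w ^ n)) holomorphic_on ball 0 R"
  proof (rule holomorphic_on_compose_gen[OF _ hol, unfolded o_def])
    show "(\<lambda>w::complex. w ^ n) ` ball 0 R \<subseteq> ball 0 (R ^ n)"
      by (intro image_subsetI iffD1[OF in_ball])
  qed (intro holomorphic_intros)
  then show "(\<lambda>w. cyclic_component n k g (w ^ n)) holomorphic_on ball 0 R"
    by (rule holomorphic_transform) (simp only: component iffD1[OF in_ball])
  show "w ^ k * cyclic_component n k g (w ^ n) = cyclic_average n k g w" if w: "w \<in> ball 0 R"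
  proof -
    have pow: "w ^ k * (a (l * n + k) * (w ^ n - 0) ^ l) = a (l * n + k) * w ^ (l * n + k)" for l
      by (simp add: power_add power_mult[symmetric] mult.commute[of n])
    have "(\<lambda>l. w ^ k * (a (l * n + k) * (w ^ n - 0) ^ l)) sums (w ^ k * h (w ^ n))"
      by (intro sums_mult h_sums iffD1[OF in_ball] w)
    then have "(\<lambda>l. a (l * n + k) * w ^ (l * n + k)) sums (w ^ k * h (w ^ n))"
      unfolding pow .
    then have "w ^ k * h (w ^ n) = cyclic_average n k g w"
      using average[OF w] sums_unique2 by blast
    then show ?thesis
      by (simp only: component[OF iffD1[OF in_ball[of w] w]])
  qed
qed

section \<open>The multicentric representation\<close>

text \<open>
  On the fibre \<open>w = p(\<zeta>) = (\<zeta> - x) q(\<zeta>)\<close> the factor \<open>x - \<zeta>\<close> cancels from \<open>-w / (p'(\<zeta>) (x - \<zeta>))\<close>,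
  provided that \<open>\<zeta> \<noteq> x\<close>, that is, \<open>w \<noteq> 0\<close>. Excluding one value of \<open>w\<close> does not affect
  \<open>remove_sings\<close>.
\<close>

lemma multicentric_fun_eq_fibre_sum:
  assumes p: "p = [:-x, 1:] * q"
  shows "multicentric_fun p \<phi> x = remove_sings (fibre_sum p (\<lambda>\<zeta>. poly q \<zeta> * \<phi> \<zeta>))"
proof
  fix w\<^sub>0 :: complex
  have "eventually (\<lambda>w. w \<noteq> 0) (at w\<^sub>0)"
    by (rule eventually_neq_at_within)
  then have "eventually (\<lambda>w. (\<Sum>\<zeta> | poly p \<zeta> = w. lagrange_basis_at p \<zeta> x w * \<phi> \<zeta>) =
               fibre_sum p (\<lambda>\<zeta>. poly q \<zeta> * \<phi> \<zeta>) w) (at w\<^sub>0)"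
  proof eventually_elim
    case (elim w)
    show ?case
      unfolding fibre_sum_def
    proof (intro sum.cong refl)
      fix \<zeta> assume "\<zeta> \<in> {\<zeta>. poly p \<zeta> = w}"
      then have w: "w = (\<zeta> - x) * poly q \<zeta>"
        by (simp add: p algebra_simps)
      have "\<zeta> \<noteq> x"
        using elim w by auto
      moreover have "poly p x - w = poly q \<zeta> * (x - \<zeta>)"
        using w by (simp add: p algebra_simps)
      ultimately have "lagrange_basis_at p \<zeta> x w = poly q \<zeta> / poly (pderiv p) \<zeta>"
        by (simp add: lagrange_basis_at_def)
      then show "lagrange_basis_at p \<zeta> x w * \<phi> \<zeta> = poly q \<zeta> * \<phi> \<zeta> / poly (pderiv p) \<zeta>"
        by simp
    qed
  qed
  then show "multicentric_fun p \<phi> x w\<^sub>0 = remove_sings (fibre_sum p (\<lambda>\<zeta>. poly q \<zeta> * \<phi> \<zeta>)) w\<^sub>0"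
    unfolding multicentric_fun_def by (rule remove_sings_cong) simp
qed

definition cofactor :: "(nat \<Rightarrow> complex) \<Rightarrow> nat \<Rightarrow> nat \<Rightarrow> complex poly" where
  "cofactor lam d j = (\<Prod>l\<in>{1..d} - {j}. [:-lam l, 1:])"

lemma poly_cofactor: "poly (cofactor lam d j) z = (\<Prod>l\<in>{1..d} - {j}. z - lam l)"
  by (simp add: cofactor_def poly_prod)

lemma cofactor_at_root:
  assumes "inj_on lam {1..d}" "i \<in> {1..d}" "j \<in> {1..d}"
  shows "poly (cofactor lam d j) (lam i) = 0 \<longleftrightarrow> i \<noteq> j"
  using assms(2,3) inj_on_eq_iff[OF assms(1)] by (simp add: poly_cofactor)

lemma degree_cofactor:
  assumes "j \<in> {1..d}"
  shows "degree (cofactor lam d j) < d"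
proof -
  have "degree (cofactor lam d j) = (\<Sum>l\<in>{1..d} - {j}. degree [:-lam l, 1:])"
    unfolding cofactor_def by (rule degree_prod_eq_sum_degree) simp
  also have "\<dots> < d"
    using assms by auto
  finally show ?thesis .
qed

lemma monic_poly_eq_prod_roots:
  fixes p :: "complex poly"
  assumes "lead_coeff p = 1" "degree p = d" "bij_betw lam {1..d} {z. poly p z = 0}"
  shows "p = (\<Prod>l\<in>{1..d}. [:-lam l, 1:])"
proof (rule poly_eqI_degree_lead_coeff[where n = d and A = "{z. poly p z = 0}"])
  have deg: "degree (\<Prod>l\<in>{1..d}. [:-lam l, 1:]) = d"
    by (subst degree_prod_eq_sum_degree) auto
  moreover have "lead_coeff (\<Prod>l\<in>{1..d}. [:-lam l, 1:]) = 1"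
    by (simp add: lead_coeff_prod)
  ultimately show "coeff p d = coeff (\<Prod>l\<in>{1..d}. [:-lam l, 1:]) d"
    using assms by simp
  show "degree (\<Prod>l\<in>{1..d}. [:-lam l, 1:]) \<le> d"
    using deg by simp
  show "card {z. poly p z = 0} \<ge> d"
    using bij_betw_same_card[OF assms(3)] by simp
  show "poly p z = poly (\<Prod>l\<in>{1..d}. [:-lam l, 1:]) z" if "z \<in> {z. poly p z = 0}" for z
  proof -
    have "z \<in> lam ` {1..d}"
      using that bij_betw_imp_surj_on[OF assms(3)] by simp
    then obtain i where "i \<in> {1..d}" "z = lam i"
      by blast
    then show ?thesis
      using that by (auto simp: poly_prod)
  qed
  show "degree p \<le> d"
    by (simp add: assms(2))
qed

lemma monic_poly_eq_linear_mult_cofactor: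
  fixes p :: "complex poly"
  assumes "lead_coeff p = 1" "degree p = d" "bij_betw lam {1..d} {z. poly p z = 0}" "j \<in> {1..d}"
  shows "p = [:-lam j, 1:] * cofactor lam d j"
  unfolding cofactor_def
  by (rule trans[OF monic_poly_eq_prod_roots[OF assms(1-3)]
        prod.remove[OF finite_atLeastAtMost assms(4)]])

lemma poly_pderiv_linear_mult: "poly (pderiv ([:-a, 1:] * q)) a = poly q a"
  for a :: complex
  by (simp only: pderiv_mult) (simp add: pderiv_pCons)

text \<open>
  The quotient \<open>s = (p - p(\<zeta>)) / (X - \<zeta>)\<close> has degree below \<open>d\<close> and takes the value
  \<open>poly (cofactor lam d j) \<zeta>\<close> at \<open>lam j\<close>. So the left-hand side is the Lagrange interpolant of \<open>s\<close>,
  that is \<open>s\<close> itself, evaluated at \<open>z\<close>.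
\<close>

lemma bezout_interpolation:
  fixes p :: "complex poly"
  assumes p: "lead_coeff p = 1" "degree p = d" "bij_betw lam {1..d} {z. poly p z = 0}"
    and same: "poly p z = poly p \<zeta>"
  shows "(\<Sum>j=1..d. lagrange_basis p lam d j z * poly (cofactor lam d j) \<zeta>) =
         (if z = \<zeta> then poly (pderiv p) \<zeta> else 0)"
proof (cases "d = 0")
  case True
  then obtain c where "p = [:c:]"
    using p(2) degree_eq_zeroE by blast
  then show ?thesis
    using True by simp
next
  case False
  note fac = monic_poly_eq_linear_mult_cofactor[OF p]
  have inj: "inj_on lam {1..d}" and roots: "lam ` {1..d} = {z. poly p z = 0}"
    using p(3) by (auto simp: bij_betw_def)
  have "poly (p - [:poly p \<zeta>:]) \<zeta> = 0"
    by simp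
  then obtain s where s: "p - [:poly p \<zeta>:] = [:-\<zeta>, 1:] * s"
    unfolding poly_eq_0_iff_dvd by (elim dvdE)
  have s_eval: "poly p y - poly p \<zeta> = (y - \<zeta>) * poly s y" for y
    using arg_cong[OF s, of "\<lambda>r. poly r y"] by (simp add: algebra_simps)
  have card: "card (lam ` {1..d}) = d"
    by (subst card_image[OF inj]) simp
  have "pderiv (p - [:poly p \<zeta>:]) = pderiv p"
    by (simp add: pderiv_diff pderiv_pCons)
  then have s_diag: "poly s \<zeta> = poly (pderiv p) \<zeta>"
    using poly_pderiv_linear_mult[of \<zeta> s] by (simp only: s[symmetric])
  have "s \<noteq> 0"
  proof
    assume "s = 0"
    then have "p = [:poly p \<zeta>:]"
      using s by simp
    then have "degree p = 0"
      by (metis degree_pCons_0)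
    then show False
      using False p(2) by simp
  qed
  have "degree (p - [:poly p \<zeta>:]) \<le> d"
    using p(2) by (intro degree_diff_le) auto
  moreover have "degree (p - [:poly p \<zeta>:]) = Suc (degree s)"
    unfolding s using \<open>s \<noteq> 0\<close> by (subst degree_mult_eq) auto
  ultimately have deg_s: "degree s < d"
    by simp
  define L where "L = (\<Sum>j=1..d. smult (poly (cofactor lam d j) \<zeta> / poly (pderiv p) (lam j)) (cofactor lam d j))"
  have "L = s"
  proof (rule poly_eqI_degree[where A = "lam ` {1..d}"])
    have "degree L \<le> d - 1"
      unfolding L_def
    proof (rule degree_sum_le)
      fix j assume "j \<in> {1..d}"
      then show "degree (smult (poly (cofactor lam d j) \<zeta> / poly (pderiv p) (lam j)) (cofactor lam d j)) \<le> d - 1"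
        using degree_cofactor[of j d lam] by (intro order.trans[OF degree_smult_le]) simp
    qed simp
    then show "degree L < card (lam ` {1..d})"
      unfolding card using False by simp
    show "degree s < card (lam ` {1..d})"
      unfolding card by (rule deg_s)
    fix x assume "x \<in> lam ` {1..d}"
    then obtain i where i: "i \<in> {1..d}" "x = lam i"
      by blast
    have diag: "poly (pderiv p) (lam i) = poly (cofactor lam d i) (lam i)"
      using arg_cong[OF fac[OF i(1)], of "\<lambda>r. poly (pderiv r) (lam i)"]
      by (simp only: poly_pderiv_linear_mult)
    have "poly L x = (\<Sum>j=1..d. if j = i then poly (cofactor lam d i) \<zeta> else 0)"
      unfolding L_def poly_sum
    proof (rule sum.cong)
      fix j assume j: "j \<in> {1..d}"
      show "poly (smult (poly (cofactor lam d j) \<zeta> / poly (pderiv p) (lam j)) (cofactor lam d j)) x =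
            (if j = i then poly (cofactor lam d i) \<zeta> else 0)"
        using cofactor_at_root[OF inj i(1) j] by (auto simp: i(2) diag)
    qed simp
    also have "\<dots> = poly (cofactor lam d i) \<zeta>"
      using i(1) by simp
    also have "\<dots> = poly s x"
    proof (cases "\<zeta> = x")
      case True
      then show ?thesis
        using s_diag diag i(2) by simp
    next
      case False
      have "poly p x = 0"
        using i roots by blast
      then have "(\<zeta> - x) * poly s x = poly p \<zeta>"
        using s_eval[of x] by (simp add: algebra_simps)
      also have "\<dots> = (\<zeta> - x) * poly (cofactor lam d i) \<zeta>"
        by (subst fac[OF i(1)]) (simp add: i(2) algebra_simps)
      finally show ?thesis
        using False by simp
    qed
    finally show "poly L x = poly s x" .
  qed
  have "(\<Sum>j=1..d. lagrange_basis p lam d j z * poly (cofactor lam d j) \<zeta>) = poly L z"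
    unfolding L_def poly_sum by (intro sum.cong refl) (simp add: lagrange_basis_def poly_cofactor)
  also have "\<dots> = (if z = \<zeta> then poly (pderiv p) \<zeta> else 0)"
    using s_eval[of z] same s_diag \<open>L = s\<close> by auto
  finally show ?thesis .
qed

lemma multicentric_fun_holomorphic:
  fixes p :: "complex poly"
  assumes "degree p > 0" "poly p x = 0" "open B" "\<phi> holomorphic_on {z. poly p z \<in> B}"
  shows "multicentric_fun p \<phi> x holomorphic_on B"
proof -
  obtain q where q: "p = [:-x, 1:] * q"
    using assms(2) unfolding poly_eq_0_iff_dvd by (elim dvdE)
  show ?thesis
    unfolding multicentric_fun_eq_fibre_sum[OF q]
    by (intro remove_sings_fibre_sum_holomorphic assms holomorphic_intros)
qed

text \<open>
  Over a regular value, exchanging the sums over \<open>j\<close> and over the fibre makes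
  \<open>bezout_interpolation\<close> applicable, which leaves the summand \<open>\<zeta> = z\<close> only. The points over critical
  values are isolated, and both sides are continuous.
\<close>

lemma multicentric_representation:
  fixes p :: "complex poly"
  assumes p: "lead_coeff p = 1" "degree p = d" "bij_betw lam {1..d} {z. poly p z = 0}"
    and d: "d > 0" and B: "open B" and \<phi>: "\<phi> holomorphic_on {z. poly p z \<in> B}"
    and z: "poly p z \<in> B"
  shows "\<phi> z = (\<Sum>j=1..d. lagrange_basis p lam d j z * multicentric_fun p \<phi> (lam j) (poly p z))"
proof -
  define C where "C = poly p ` {\<zeta>. poly (pderiv p) \<zeta> = 0}"
  define U where "U = {z. poly p z \<in> B}"
  define \<psi> where "\<psi> = (\<lambda>z. \<Sum>j=1..d. lagrange_basis p lam d j z * multicentric_fun p \<phi> (lam j) (poly p z))"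
  have deg: "degree p > 0"
    using p(2) d by simp
  have f_eq: "multicentric_fun p \<phi> (lam j) =
      remove_sings (fibre_sum p (\<lambda>\<zeta>. poly (cofactor lam d j) \<zeta> * \<phi> \<zeta>))" if "j \<in> {1..d}" for j
    by (rule multicentric_fun_eq_fibre_sum[OF monic_poly_eq_linear_mult_cofactor[OF p that]])
  have regular: "\<psi> y = \<phi> y" if y: "y \<in> U" "poly p y \<notin> C" for y
  proof -
    define w where "w = poly p y"
    have reg: "poly (pderiv p) \<zeta> \<noteq> 0" if "poly p \<zeta> = w" for \<zeta>
    proof
      assume "poly (pderiv p) \<zeta> = 0"
      then have "poly p \<zeta> \<in> C"
        by (simp add: C_def)
      then show False
        using that y(2) by (simp add: w_def)
    qed
    have f: "multicentric_fun p \<phi> (lam j) w =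
        (\<Sum>\<zeta> | poly p \<zeta> = w. poly (cofactor lam d j) \<zeta> * \<phi> \<zeta> / poly (pderiv p) \<zeta>)" if "j \<in> {1..d}" for j
    proof -
      have "fibre_sum p (\<lambda>\<zeta>. poly (cofactor lam d j) \<zeta> * \<phi> \<zeta>) analytic_on {w}"
      proof (rule fibre_sum_analytic_at_regular_value[OF deg B _ _ reg])
        show "(\<lambda>\<zeta>. poly (cofactor lam d j) \<zeta> * \<phi> \<zeta>) holomorphic_on {z. poly p z \<in> B}"
          by (intro holomorphic_intros \<phi>)
      qed (use y(1) in \<open>auto simp: w_def U_def\<close>)
      then show ?thesis
        unfolding f_eq[OF that] by (simp add: remove_sings_at_analytic fibre_sum_def)
    qed
    have "\<psi> y = (\<Sum>j=1..d. \<Sum>\<zeta> | poly p \<zeta> = w. lagrange_basis p lam d j y *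
                  (poly (cofactor lam d j) \<zeta> * \<phi> \<zeta> / poly (pderiv p) \<zeta>))"
      unfolding \<psi>_def w_def[symmetric] by (intro sum.cong refl) (simp add: f sum_distrib_left)
    also have "\<dots> = (\<Sum>\<zeta> | poly p \<zeta> = w. (\<Sum>j=1..d. lagrange_basis p lam d j y * poly (cofactor lam d j) \<zeta>) *
                       (\<phi> \<zeta> / poly (pderiv p) \<zeta>))"
      by (subst sum.swap) (simp add: sum_distrib_right sum_divide_distrib mult.assoc)
    also have "\<dots> = (\<Sum>\<zeta> | poly p \<zeta> = w. if y = \<zeta> then \<phi> y else 0)"
    proof (intro sum.cong refl)
      fix \<zeta> assume "\<zeta> \<in> {\<zeta>. poly p \<zeta> = w}"
      then have \<zeta>: "poly p \<zeta> = w"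
        by simp
      then show "(\<Sum>j=1..d. lagrange_basis p lam d j y * poly (cofactor lam d j) \<zeta>) *
                   (\<phi> \<zeta> / poly (pderiv p) \<zeta>) = (if y = \<zeta> then \<phi> y else 0)"
        using bezout_interpolation[OF p, of y \<zeta>] reg[OF \<zeta>] by (simp add: w_def)
    qed
    also have "\<dots> = \<phi> y"
      using finite_poly_fibre(1)[OF deg, of w] by (simp add: w_def)
    finally show ?thesis .
  qed
  have openU: "open U"
    unfolding U_def using open_vimage[OF B, of "poly p"] by (simp add: vimage_def continuous_on_poly)
  have zU: "z \<in> U"
    using z by (simp add: U_def)
  have "\<psi> holomorphic_on U"
    unfolding \<psi>_def lagrange_basis_def
  proof (intro holomorphic_intros)
    fix j assume j: "j \<in> {1..d}"
    have "multicentric_fun p \<phi> (lam j) holomorphic_on B"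
      using p(3) j by (intro multicentric_fun_holomorphic deg B \<phi>) (auto simp: bij_betw_def)
    moreover have "poly p ` U \<subseteq> B"
      by (auto simp: U_def)
    moreover have "poly p holomorphic_on U"
      by (intro holomorphic_intros)
    ultimately show "(\<lambda>z. multicentric_fun p \<phi> (lam j) (poly p z)) holomorphic_on U"
      using holomorphic_on_compose_gen[of "poly p" U _ B] by (simp add: o_def)
  qed
  then have lim_\<psi>: "(\<psi> \<longlongrightarrow> \<psi> z) (at z)"
    using continuous_on_eq_continuous_at[OF openU] zU holomorphic_on_imp_continuous_on isCont_def by blast
  have lim_\<phi>: "(\<phi> \<longlongrightarrow> \<phi> z) (at z)"
    using continuous_on_eq_continuous_at[OF openU] zU holomorphic_on_imp_continuous_on isCont_def
      \<phi>[folded U_def] by blast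
  have "{y. poly p y \<in> C} = (\<Union>c\<in>C. {y. poly p y = c})"
    by auto
  then have "finite {y. poly p y \<in> C}"
    using finite_critical_points[OF deg] finite_poly_fibre(1)[OF deg] by (simp add: C_def)
  then have "open (U - ({y. poly p y \<in> C} - {z}))"
    using openU by (intro open_Diff finite_imp_closed) auto
  then have "eventually (\<lambda>y. y \<in> U - ({y. poly p y \<in> C} - {z}) - {z}) (at z)"
    using zU by (intro eventually_at_in_open) auto
  then have "eventually (\<lambda>y. \<psi> y = \<phi> y) (at z)"
    by eventually_elim (auto intro: regular)
  then have "(\<phi> \<longlongrightarrow> \<psi> z) (at z)"
    using lim_\<psi> by (rule Lim_transform_eventually[rotated])
  then show ?thesis
    using lim_\<phi> tendsto_unique[OF at_neq_bot] unfolding \<psi>_def by blast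
qed

text \<open>
  The values \<open>w\<close> whose whole fibre lies in the domain of \<open>\<phi>\<close> form an open set containing the compact
  disc \<open>|w| \<le> \<rho>\<close>, hence also a larger concentric disc.
\<close>

lemma analytic_on_sublevel_extend:
  fixes p :: "complex poly"
  assumes deg: "degree p > 0" and \<rho>: "\<rho> \<ge> 0" and \<phi>: "\<phi> analytic_on poly_sublevel p \<rho>"
  obtains R where "R > \<rho>" "\<phi> holomorphic_on {z. poly p z \<in> ball 0 R}"
proof -
  obtain U where U: "open U" "poly_sublevel p \<rho> \<subseteq> U" "\<phi> holomorphic_on U"
    using \<phi> analytic_on_holomorphic by blast
  define K where "K = - (poly p ` (- U))"
  have "open K"
    unfolding K_def using U(1) by (intro open_Compl closed_poly_image[OF deg]) (simp add: closed_Compl)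
  moreover have "cball 0 \<rho> \<subseteq> K"
    using U(2) by (auto simp: K_def poly_sublevel_def)
  ultimately obtain e where e: "e > 0" "(\<Union>w\<in>cball 0 \<rho>. ball w e) \<subseteq> K"
    using compact_subset_open_imp_ball_epsilon_subset[OF compact_cball] by metis
  have "ball 0 (\<rho> + e) \<subseteq> K"
  proof
    fix w :: complex assume w: "w \<in> ball 0 (\<rho> + e)"
    show "w \<in> K"
    proof (cases "norm w \<le> \<rho>")
      case True
      then show ?thesis
        using \<open>cball 0 \<rho> \<subseteq> K\<close> by auto
    next
      case False
      then have "norm w \<noteq> 0"
        using \<rho> by linarith
      \<comment> \<open>The point of the disc nearest to \<open>w\<close>.\<close>
      define v where "v = of_real (\<rho> / norm w) * w"
      have "w - v = of_real ((norm w - \<rho>) / norm w) * w"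
        using \<open>norm w \<noteq> 0\<close> by (simp add: v_def field_simps)
      then have "norm (w - v) = norm w - \<rho>"
        using False \<rho> \<open>norm w \<noteq> 0\<close> by (simp only: norm_mult norm_of_real) simp
      moreover have "v \<in> cball 0 \<rho>"
        using \<rho> \<open>norm w \<noteq> 0\<close> by (simp only: mem_cball_0 v_def norm_mult norm_of_real) simp
      ultimately show ?thesis
        using w e(2) by (force simp: dist_norm norm_minus_commute)
    qed
  qed
  then have "{z. poly p z \<in> ball 0 (\<rho> + e)} \<subseteq> U"
    unfolding K_def by blast
  then show ?thesis
    using that[of "\<rho> + e"] e(1) holomorphic_on_subset[OF U(3)] by simp
qed

section \<open>The cyclic multicentric representation\<close>

theorem theorem2p1:
  fixes p :: "complex poly" and lam :: "nat \<Rightarrow> complex" and d n :: nat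
    and \<rho> :: real and \<phi> :: "complex \<Rightarrow> complex"
    and f :: "nat \<Rightarrow> complex \<Rightarrow> complex" and F :: "nat \<Rightarrow> nat \<Rightarrow> complex \<Rightarrow> complex"
  defines "f \<equiv> \<lambda>j. multicentric_fun p \<phi> (lam j)"
    and "F \<equiv> \<lambda>j k. cyclic_component n k (f j)"
  assumes "lead_coeff p = 1" and "degree p = d"
    and "rsquarefree p" and "bij_betw lam {1..d} {z. poly p z = 0}"
    and "n > 0" and "\<rho> > 0"
    and "\<phi> analytic_on poly_sublevel p \<rho>"
    and "\<And>z. z \<in> poly_sublevel p \<rho> \<Longrightarrow>
           \<phi> z = (\<Sum>j=1..d. lagrange_basis p lam d j z * f j (poly p z))"
  shows "\<exists>R>\<rho>.
     (\<forall>z. cmod (poly p z) < R \<longrightarrow>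
        \<phi> z = (\<Sum>j=1..d. lagrange_basis p lam d j z *
                 (\<Sum>k<n. poly p z ^ k * F j k (poly p z ^ n)))) \<and>
     (\<forall>j\<in>{1..d}. \<forall>k<n.
        (\<lambda>w. F j k (w ^ n)) holomorphic_on ball 0 R \<and>
        (\<forall>w\<in>ball 0 R. w ^ k * F j k (w ^ n) =
           1 / of_nat n * (\<Sum>m<n. exp (- (2 * of_real pi * \<i> * of_nat m * of_nat k / of_nat n)) *
                                   f j (exp (2 * of_real pi * \<i> * of_nat m / of_nat n) * w))))"
proof (cases "d = 0")
  \<comment> \<open>For \<open>p = 1\<close> the sum over \<open>j\<close> is empty and the sublevel set is empty or the whole plane; in the
    first case \<open>R = 1\<close> keeps the set \<open>|p(z)| < R\<close> empty, in the second \<open>\<phi>\<close> vanishes identically.\<close>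
  case True
  then obtain c where "p = [:c:]"
    using assms(4) degree_eq_zeroE by blast
  with assms(3) have p: "p = 1"
    by (simp add: one_pCons)
  define R where "R = (if \<rho> < 1 then 1 else \<rho> + 1)"
  have "\<phi> z = 0" if "cmod (poly p z) < R" for z
    using assms(10)[of z] that True by (auto simp: p R_def poly_sublevel_def split: if_splits)
  then show ?thesis
    using True by (intro exI[of _ R]) (auto simp: R_def)
next
  case False
  then have d: "d > 0" and deg: "degree p > 0"
    using assms(4) by auto
  obtain R where R: "R > \<rho>" and hol: "\<phi> holomorphic_on {z. poly p z \<in> ball 0 R}"
    using analytic_on_sublevel_extend[OF deg less_imp_le[OF assms(8)] assms(9)] .
  have "R > 0"
    using R assms(8) by simp
  have f: "f j holomorphic_on ball 0 R" if "j \<in> {1..d}" for j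
    unfolding f_def
  proof (rule multicentric_fun_holomorphic[OF deg _ open_ball hol])
    show "poly p (lam j) = 0"
      using bij_betw_apply[OF assms(6) that] by simp
  qed
  note component = cyclic_component_power[OF assms(7) _ \<open>R > 0\<close> f, folded F_def]
  show ?thesis
  proof (intro exI[of _ R] conjI allI impI ballI R)
    fix z assume "cmod (poly p z) < R"
    then have z: "poly p z \<in> ball 0 R"
      by simp
    have "(\<Sum>k<n. poly p z ^ k * F j k (poly p z ^ n)) = f j (poly p z)" if "j \<in> {1..d}" for j
      using component(2)[OF _ that z] sum_cyclic_average[OF assms(7), of "f j" "poly p z"] by (simp add: F_def)
    then show "\<phi> z = (\<Sum>j=1..d. lagrange_basis p lam d j z *
                 (\<Sum>k<n. poly p z ^ k * F j k (poly p z ^ n)))"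
      using multicentric_representation[OF assms(3,4,6) d open_ball hol z] by (simp add: f_def)
  next
    fix j k assume j: "j \<in> {1..d}" and k: "k < n"
    show "(\<lambda>w. F j k (w ^ n)) holomorphic_on ball 0 R"
      using component(1)[OF k j] by (simp add: F_def)
    fix w :: complex assume w: "w \<in> ball 0 R"
    show "w ^ k * F j k (w ^ n) =
           1 / of_nat n * (\<Sum>m<n. exp (- (2 * of_real pi * \<i> * of_nat m * of_nat k / of_nat n)) *
                                   f j (exp (2 * of_real pi * \<i> * of_nat m / of_nat n) * w))"
      using component(2)[OF k j w] by (simp add: F_def cyclic_average_def)
  qed
qed

end
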